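(* Let $k,t,s$ be fixed positive integers with $k\geq 2$ and $t\geq s\geq 1$. If $$n\geq 1+\max \left\{2(sk(k-1)+t-1),\ 2^{2s(1+\frac{3}{2k-2})}(t-1)^{\frac{1}{k-1}}(k-1) \right\},$$ then any $(s,t)$-union intersecting family $\mathcal{A}\subseteq{[n]\choose k}$ has cardinality at most ${n-1\choose k-1}+s-1$. Moreover, equality holds if and only if there is an $i\in[n]$ such that $\mathcal{A}$ is the union of the star $\mathcal{S}_i$ and $s-1$ members of ${[n]\choose k}\setminus \mathcal{S}_i$.
   Context: ${[n]\choose k}$ denotes the family of all $k$-subsets of $[n]=\{1,\ldots,n\}$. For $i\in[n]$, $\mathcal{S}_i=\{A\in{[n]\choose k}: i\in A\}$. For positive integers $t\geq s$, a family $\mathcal{A}\subseteq{[n]\choose k}$ is $(s,t)$-union intersecting if for every $s$-element subfamily $\{A_1,\ldots,A_s\}\subseteq\mathcal{A}$ and every $t$-element subfamily $\{B_1,\ldots,B_t\}\subseteq\mathcal{A}$ we have $\left(\bigcup_{i=1}^s A_i\right)\cap\left(\bigcup_{i=1}^t B_i\right)\neq\varnothing$. *)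

theory Defs
  imports Complex_Main "HOL-Library.Ramsey"
begin

definition star :: "nat \<Rightarrow> nat \<Rightarrow> nat \<Rightarrow> nat set set" where
  "star n k i = {A \<in> nsets {1..n} k. i \<in> A}"

text \<open>The two subfamilies each consist of distinct members, but they may overlap.\<close>

definition union_intersecting :: "nat \<Rightarrow> nat \<Rightarrow> nat set set \<Rightarrow> bool" where
  "union_intersecting s t \<A> \<longleftrightarrow>
     (\<forall>F \<in> nsets \<A> s. \<forall>G \<in> nsets \<A> t. \<Union>F \<inter> \<Union>G \<noteq> {})"

end

theory Submission
  imports Defs
begin

text \<open>
  The union-intersecting condition says that the disjointness graph on \<open>\<A>\<close> contains no
  complete bipartite graph with parts of sizes \<open>s\<close> and \<open>t\<close>. Write \<open>M = (n - 1) choose (k - 1)\<close>.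

  If some \<open>i\<close> is missed by at most \<open>s - 1\<close> members of \<open>\<A>\<close>, the bound and the equality case
  are immediate. Otherwise, \<open>s\<close> members avoiding \<open>i\<close> have fewer than \<open>t\<close> common neighbours, so that
  nearly all members through \<open>i\<close> meet their union; hence every point has degree at most \<open>M / 2\<close>.
  By the Bollobas set-pair inequality, a subfamily of at most \<open>C = (2 * k) choose k\<close> sets dominates all
  non-isolated vertices of the graph. Peeling off such dominating sets \<open>s\<close> times
  leaves an intersecting family \<open>W\<close>, up to \<open>(s - 1) * C\<close> removed sets and at most \<open>C ^ s * (t - 1)\<close> sets
  which have a neighbour in each of the \<open>s\<close> layers; the exponential lower bound on \<open>n\<close> makes these exceptions
  at most \<open>M / 4\<close>. A slightly weakened Hilton-Milner theorem, proved by shifting, gives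
  \<open>card W < 3 * M / 4\<close>, so \<open>card \<A> < M\<close>.
\<close>

section \<open>Dominating sets in the disjointness graph\<close>

definition cross_intersecting :: "'a set set \<Rightarrow> 'a set set \<Rightarrow> bool" where
  "cross_intersecting P Q \<longleftrightarrow> (\<forall>A\<in>P. \<forall>B\<in>Q. A \<inter> B \<noteq> {})"

lemma card_nsets: "finite X \<Longrightarrow> card (nsets X k) = card X choose k"
  by (subst n_subsets[symmetric])
     (auto simp: nsets_def intro!: arg_cong[where f = card] dest: finite_subset)

text \<open>Averaging over a deleted point \<open>x\<close>: keeping the pairs with \<open>x\<close>
  outside \<open>A i\<close> and removing \<open>x\<close> from \<open>B i\<close> preserves the
  hypotheses. Summed over all \<open>x\<close> in \<open>X\<close>, the inductive inequalities give
  exactly \<open>card X\<close> times the wanted sum.\<close>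

lemma bollobas_set_pairs:
  fixes A B :: "'i \<Rightarrow> 'a set"
  assumes "finite X" "finite I"
    and "\<And>i. i \<in> I \<Longrightarrow> A i \<subseteq> X" "\<And>i. i \<in> I \<Longrightarrow> B i \<subseteq> X"
    and "\<And>i. i \<in> I \<Longrightarrow> A i \<inter> B i = {}"
    and "\<And>i j. i \<in> I \<Longrightarrow> j \<in> I \<Longrightarrow> i \<noteq> j \<Longrightarrow> A i \<inter> B j \<noteq> {}"
  shows "(\<Sum>i\<in>I. 1 / real ((card (A i) + card (B i)) choose card (A i))) \<le> 1"
  using assms
proof (induction "card X" arbitrary: X I B rule: less_induct)
  case less
  show ?case
  \<comment> \<open>An empty \<open>B i\<close> meets no \<open>A j\<close>, so it must be the only
    pair. Afterwards every \<open>B i\<close> has positive size, as the absorption identity below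
    requires.\<close>
  proof (cases "\<exists>i\<in>I. B i = {}")
    case True
    then obtain i where i: "i \<in> I" "B i = {}" by blast
    then have "I = {i}" using less.prems(6) by blast
    then show ?thesis using i by simp
  next
    case False
    show ?thesis
    proof (cases "X = {}")
      case True
      then have "I = {}" using False less.prems(4) by blast
      then show ?thesis by simp
    next
      case nonempty: False
      define w where "w i b = 1 / real ((card (A i) + b) choose card (A i))" for i b
      have IH: "(\<Sum>i\<in>{i\<in>I. x \<notin> A i}. w i (card (B i - {x}))) \<le> 1" if x: "x \<in> X" for x
        unfolding w_def
      proof (rule less.hyps[where X = "X - {x}"])
        show "card (X - {x}) < card X" using x less.prems(1) by (meson card_Diff1_less)
        show "A i \<inter> (B j - {x}) \<noteq> {}" if "i \<in> {i\<in>I. x \<notin> A i}" "j \<in> {i\<in>I. x \<notin> A i}" "i \<noteq> j" for i j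
          using that less.prems(6)[of i j] by blast
      qed (use less.prems(1-5) in \<open>simp; blast\<close>)+
      \<comment> \<open>A point of \<open>B i\<close> lowers \<open>b\<close> by one and so
        multiplies the term by \<open>(a + b) / b\<close>; a point outside both sets leaves it
        unchanged. With \<open>b\<close> points of the first kind and \<open>card X - a - b\<close>
        of the second, the factors add up to \<open>card X\<close>.\<close>
      have each: "(\<Sum>x\<in>{x\<in>X. x \<notin> A i}. w i (card (B i - {x}))) = real (card X) * w i (card (B i))"
        if i: "i \<in> I" for i
      proof -
        have fin: "finite (A i)" "finite (B i)"
          using less.prems(1,3,4) i finite_subset by metis+
        define a b where "a = card (A i)" and "b = card (B i)"
        have b: "b > 0" using False i fin by (auto simp: b_def card_gt_0_iff)
        have split: "{x\<in>X. x \<notin> A i} = B i \<union> (X - A i - B i)"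
          using less.prems(4)[OF i] less.prems(5)[OF i] by blast
        have cd: "card (X - A i - B i) + a + b = card X"
        proof -
          have "card (A i \<union> B i) = a + b"
            using less.prems(5)[OF i] fin by (simp add: card_Un_disjoint a_def b_def)
          moreover have "card (A i \<union> B i) \<le> card X"
            using less.prems i by (intro card_mono) auto
          moreover have "card (X - (A i \<union> B i)) = card X - card (A i \<union> B i)"
            using less.prems i fin by (intro card_Diff_subset) auto
          moreover have "X - A i - B i = X - (A i \<union> B i)" by blast
          ultimately show ?thesis by simp
        qed
        have "(\<Sum>x\<in>{x\<in>X. x \<notin> A i}. w i (card (B i - {x}))) =
            (\<Sum>x\<in>B i. w i (card (B i - {x}))) + (\<Sum>x\<in>X - A i - B i. w i (card (B i - {x})))"
          unfolding split using fin less.prems(1) by (intro sum.union_disjoint) auto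
        also have "(\<Sum>x\<in>B i. w i (card (B i - {x}))) = real b * w i (b - 1)"
          by (simp add: b_def)
        also have "(\<Sum>x\<in>X - A i - B i. w i (card (B i - {x}))) = real (card (X - A i - B i)) * w i b"
          by (simp add: b_def)
        also have "real b * w i (b - 1) = real (a + b) * w i b"
        proof -
          have "(a + b - a) * ((a + b) choose a) = (a + b) * ((a + b - 1) choose a)"
            by (rule binomial_absorb_comp)
          moreover have "a + b - 1 = a + (b - 1)" using b by simp
          ultimately have "b * ((a + b) choose a) = (a + b) * ((a + (b - 1)) choose a)" by simp
          then have "real b * real ((a + b) choose a) = real (a + b) * real ((a + (b - 1)) choose a)"
            by (metis of_nat_mult)
          moreover have "(a + b) choose a > 0" "(a + (b - 1)) choose a > 0" by simp_all
          ultimately show ?thesis unfolding w_def a_def[symmetric] by (simp add: field_simps)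
        qed
        also have "real (a + b) * w i b + real (card (X - A i - B i)) * w i b = real (card X) * w i b"
          using cd by (simp add: cd[symmetric] algebra_simps)
        finally show ?thesis by (simp add: b_def)
      qed
      have "real (card X) * (\<Sum>i\<in>I. w i (card (B i)))
          = (\<Sum>i\<in>I. \<Sum>x\<in>{x\<in>X. x \<notin> A i}. w i (card (B i - {x})))"
        by (simp add: each sum_distrib_left)
      also have "\<dots> = (\<Sum>x\<in>X. \<Sum>i\<in>{i\<in>I. x \<notin> A i}. w i (card (B i - {x})))"
        using less.prems by (intro sum.swap_restrict) auto
      also have "\<dots> \<le> real (card X) * 1" by (rule sum_bounded_above) (rule IH)
      finally have "real (card X) * (\<Sum>i\<in>I. w i (card (B i))) \<le> real (card X) * 1" .
      moreover have "real (card X) > 0" using nonempty less.prems(1) by (simp add: card_gt_0_iff)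
      ultimately have "(\<Sum>i\<in>I. w i (card (B i))) \<le> 1" by (simp only: mult_le_cancel_left_pos)
      then show ?thesis by (simp add: w_def)
    qed
  qed
qed

text \<open>In a dominating family \<open>D\<close> of least size each \<open>d\<close> has a
  private neighbour \<open>b d\<close>, disjoint from \<open>d\<close> but from no other member of
  \<open>D\<close>. The pairs \<open>(d, b d)\<close> satisfy the set-pair inequality, in which
  every term is the reciprocal of \<open>(2 * k) choose k\<close>.\<close>

lemma dominating_subfamily:
  assumes "finite V" and k: "\<And>A. A \<in> V \<Longrightarrow> finite A \<and> card A = k"
  obtains D where "D \<subseteq> V" "card D \<le> (2 * k) choose k"
    "\<And>v a. v \<in> V \<Longrightarrow> a \<in> V \<Longrightarrow> v \<inter> a = {} \<Longrightarrow> \<exists>d\<in>D. v \<inter> d = {}"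
proof -
  define dom where "dom D \<longleftrightarrow> D \<subseteq> V \<and> (\<forall>v\<in>V. (\<exists>a\<in>V. v \<inter> a = {}) \<longrightarrow> (\<exists>d\<in>D. v \<inter> d = {}))" for D
  have "dom V" by (auto simp: dom_def)
  then obtain D where D: "dom D" and min: "\<And>E. dom E \<Longrightarrow> card D \<le> card E"
    by (metis (no_types) ex_has_least_nat)
  have fD: "finite D" using D assms(1) by (auto simp: dom_def dest: finite_subset)
  have "\<exists>v. v \<in> V \<and> d \<inter> v = {} \<and> (\<forall>e\<in>D - {d}. e \<inter> v \<noteq> {})" if d: "d \<in> D" for d
  proof (rule ccontr)
    assume "\<not> ?thesis"
    then have "dom (D - {d})" using D unfolding dom_def by (auto simp: Int_commute) (metis DiffI Int_commute singletonD)
    then show False using min[of "D - {d}"] card_Diff1_less[OF fD d] by simp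
  qed
  then obtain b where
    b: "\<And>d. d \<in> D \<Longrightarrow> b d \<in> V \<and> d \<inter> b d = {} \<and> (\<forall>e\<in>D - {d}. e \<inter> b d \<noteq> {})"
    by metis
  have "(\<Sum>d\<in>D. 1 / real ((card d + card (b d)) choose card d)) \<le> 1"
  proof (rule bollobas_set_pairs[where X = "\<Union>V" and A = "\<lambda>d. d"])
    show "finite (\<Union>V)" using assms by blast
    show "d \<inter> b e \<noteq> {}" if "d \<in> D" "e \<in> D" "d \<noteq> e" for d e using that b[of e] by simp
    show "b d \<subseteq> \<Union>V" "d \<inter> b d = {}" if "d \<in> D" for d using that b[of d] by auto
    show "d \<subseteq> \<Union>V" if "d \<in> D" for d using that D by (auto simp: dom_def)
  qed (rule fD)
  also have "(\<Sum>d\<in>D. 1 / real ((card d + card (b d)) choose card d)) = (\<Sum>d\<in>D. 1 / real ((2 * k) choose k))"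
    using k b D by (intro sum.cong) (auto simp: dom_def mult_2 subset_iff)
  finally have "real (card D) \<le> real ((2 * k) choose k)" by (simp add: field_simps)
  then have "card D \<le> (2 * k) choose k" by linarith
  then show thesis using that[of D] D unfolding dom_def by blast
qed

text \<open>\<open>W\<close> consists of the vertices isolated once \<open>s - 1\<close> dominating
  layers, collected in \<open>X\<close>, have been removed. The last layer is not removed, whence
  \<open>s - 1\<close> rather than \<open>s\<close>. \<open>T\<close> holds the choices of one set
  from each of the \<open>s\<close> layers.\<close>

lemma dominating_layers:
  assumes "s \<ge> 1" "finite V" "\<forall>A\<in>V. finite A \<and> card A = k"
  shows "\<exists>X W T. X \<subseteq> V \<and> card X \<le> (s - 1) * ((2 * k) choose k) \<and> W \<subseteq> V \<and>
    cross_intersecting W W \<and> T \<subseteq> nsets V s \<and> card T \<le> ((2 * k) choose k) ^ s \<and>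
    (\<forall>v\<in>V - X - W. \<exists>Y\<in>T. \<forall>A\<in>Y. v \<inter> A = {})"
  using assms
proof (induction s arbitrary: V rule: nat_induct_at_least)
  case base
  obtain D where D: "D \<subseteq> V" "card D \<le> (2 * k) choose k"
    "\<And>v a. v \<in> V \<Longrightarrow> a \<in> V \<Longrightarrow> v \<inter> a = {} \<Longrightarrow> \<exists>d\<in>D. v \<inter> d = {}"
    using dominating_subfamily[OF base(1), of k] base(2) by metis
  define W where "W = {v\<in>V. \<forall>a\<in>V. v \<inter> a \<noteq> {}}"
  have fD: "finite D" using D(1) base(1) finite_subset by blast
  have "card ((\<lambda>d. {d}) ` D) \<le> ((2 * k) choose k) ^ 1"
    using card_image_le[OF fD, of "\<lambda>d. {d}"] D(2) by simp
  moreover have "\<forall>v\<in>V - {} - W. \<exists>Y\<in>(\<lambda>d. {d}) ` D. \<forall>A\<in>Y. v \<inter> A = {}"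
    using D(3) by (auto simp: W_def)
  moreover have "(\<lambda>d. {d}) ` D \<subseteq> nsets V 1" using D(1) by (auto simp: nsets_def)
  moreover have "W \<subseteq> V" "cross_intersecting W W" by (auto simp: W_def cross_intersecting_def)
  ultimately show ?case
    by (intro exI[of _ "{}"] exI[of _ W] exI[of _ "(\<lambda>d. {d}) ` D"]) auto
next
  case (Suc s)
  obtain D where D: "D \<subseteq> V" "card D \<le> (2 * k) choose k"
    "\<And>v a. v \<in> V \<Longrightarrow> a \<in> V \<Longrightarrow> v \<inter> a = {} \<Longrightarrow> \<exists>d\<in>D. v \<inter> d = {}"
    using dominating_subfamily[OF Suc.prems(1), of k] Suc.prems(2) by metis
  have fD: "finite D" using D(1) Suc.prems(1) finite_subset by blast
  have "finite (V - D)" "\<forall>A\<in>V - D. finite A \<and> card A = k" using Suc.prems by auto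
  from Suc.IH[OF this] obtain X W T where
    X: "X \<subseteq> V - D" "card X \<le> (s - 1) * ((2 * k) choose k)" and
    W: "W \<subseteq> V - D" "cross_intersecting W W" and
    T: "T \<subseteq> nsets (V - D) s" "card T \<le> ((2 * k) choose k) ^ s"
      "\<forall>v\<in>V - D - X - W. \<exists>Y\<in>T. \<forall>A\<in>Y. v \<inter> A = {}" by (elim exE conjE)
  have fT: "finite T"
    using T(1) Suc.prems(1) finite_subset[OF T(1)] by (simp add: finite_imp_finite_nsets)
  define T' where "T' = (\<lambda>(d, Y). insert d Y) ` (D \<times> T)"
  have 1: "card (X \<union> D) \<le> (Suc s - 1) * ((2 * k) choose k)"
  proof -
    have "card (X \<union> D) \<le> (s - 1) * ((2 * k) choose k) + ((2 * k) choose k)"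
      using card_Un_le[of X D] X(2) D(2) by linarith
    also have "\<dots> = (Suc s - 1) * ((2 * k) choose k)"
      using Suc.hyps by (cases s) auto
    finally show ?thesis .
  qed
  have 2: "card T' \<le> ((2 * k) choose k) ^ Suc s"
  proof -
    have "card T' \<le> card (D \<times> T)" unfolding T'_def using fD fT by (intro card_image_le) auto
    also have "\<dots> \<le> ((2 * k) choose k) ^ Suc s"
      using D(2) T(2) by (simp add: card_cartesian_product mult_le_mono)
    finally show ?thesis .
  qed
  have 3: "T' \<subseteq> nsets V (Suc s)"
  proof
    fix Z assume "Z \<in> T'"
    then obtain d Y where "Z = insert d Y" "d \<in> D" "Y \<in> nsets (V - D) s"
      using T(1) by (auto simp: T'_def)
    then show "Z \<in> nsets V (Suc s)"
      using D(1) by (subgoal_tac "d \<notin> Y") (auto simp: nsets_def)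
  qed
  have 4: "\<exists>Y\<in>T'. \<forall>A\<in>Y. v \<inter> A = {}" if v: "v \<in> V - (X \<union> D) - W" for v
  proof -
    obtain Y where Y: "Y \<in> T" "\<forall>A\<in>Y. v \<inter> A = {}" using v T(3) by blast
    \<comment> \<open>Since \<open>s\<close> is at least 1, \<open>Y\<close> supplies a neighbour of
      \<open>v\<close>; hence \<open>v\<close> is not isolated in \<open>V\<close> and has a
      neighbour in the new layer \<open>D\<close> too.\<close>
    then have "Y \<noteq> {}" "Y \<subseteq> V" using T(1) Suc.hyps by (auto simp: nsets_def)
    then obtain A where "A \<in> V" "v \<inter> A = {}" using Y by blast
    then obtain d where "d \<in> D" "v \<inter> d = {}" using D(3) v by blast
    then show ?thesis using Y by (auto simp: T'_def intro!: bexI[of _ "(d, Y)"])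
  qed
  show ?case
    using 1 2 3 4 X(1) W D(1)
    by (intro exI[of _ "X \<union> D"] exI[of _ W] exI[of _ T']) auto
qed

section \<open>Shifting\<close>

text \<open>The Erdos-Ko-Rado compression. The exchange is blocked when its result already lies in
  the family, which makes the map injective on \<open>P\<close>.\<close>

definition shift_set :: "nat \<Rightarrow> nat \<Rightarrow> nat set set \<Rightarrow> nat set \<Rightarrow> nat set" where
  "shift_set i j P A =
     (if j \<in> A \<and> i \<notin> A \<and> insert i (A - {j}) \<notin> P then insert i (A - {j}) else A)"

definition shift :: "nat \<Rightarrow> nat \<Rightarrow> nat set set \<Rightarrow> nat set set" where
  "shift i j P = shift_set i j P ` P"

definition shifted :: "nat set \<Rightarrow> nat set set \<Rightarrow> bool" where
  "shifted X P \<longleftrightarrow>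
     (\<forall>A\<in>P. \<forall>i\<in>X. \<forall>j\<in>X. i < j \<and> j \<in> A \<and> i \<notin> A \<longrightarrow> insert i (A - {j}) \<in> P)"

text \<open>A moved set lands outside \<open>P\<close>, so it cannot collide with an unmoved one,
  and two moved sets are recovered by reversing the exchange.\<close>

lemma inj_on_shift_set: "inj_on (shift_set i j P) P"
proof (rule inj_onI)
  fix A B assume AB: "A \<in> P" "B \<in> P" "shift_set i j P A = shift_set i j P B"
  have undo: "A = insert j (insert i (A - {j}) - {i})" if "j \<in> A" "i \<notin> A" for A :: "nat set"
    using that by auto
  show "A = B"
  proof (cases "shift_set i j P A = A \<or> shift_set i j P B = B")
    case True
    then show ?thesis using AB by (metis shift_set_def)
  next
    case False
    then have "j \<in> A" "i \<notin> A" "j \<in> B" "i \<notin> B" "insert i (A - {j}) = insert i (B - {j})"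
      using AB(3) by (auto simp only: shift_set_def split: if_splits)
    then show ?thesis using undo by metis
  qed
qed

lemma card_shift: "card (shift i j P) = card P"
  unfolding shift_def by (intro card_image inj_on_shift_set)

lemma shift_subset_nsets:
  assumes "P \<subseteq> nsets X k" "i \<in> X"
  shows "shift i j P \<subseteq> nsets X k"
proof
  fix B assume "B \<in> shift i j P"
  then obtain A where A: "A \<in> P" "B = shift_set i j P A" by (auto simp: shift_def)
  then have "A \<in> nsets X k" using assms by blast
  then show "B \<in> nsets X k"
    using A(2) assms(2)
    by (auto simp: shift_set_def nsets_def card_Suc_Diff1 simp del: card_Diff_insert split: if_splits)
qed

text \<open>An unmoved set that could be exchanged was blocked, so its exchange is in
  \<open>P\<close> as well; a moved set remembers its preimage.\<close>

lemma mem_shift_cases: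
  assumes "A \<in> shift i j P"
  obtains "A \<in> P" "j \<in> A \<Longrightarrow> i \<notin> A \<Longrightarrow> insert i (A - {j}) \<in> P"
  | "i \<in> A" "insert j (A - {i}) \<in> P"
proof -
  obtain B where B: "B \<in> P" "A = shift_set i j P B" using assms by (auto simp: shift_def)
  show thesis
  proof (cases "j \<in> B \<and> i \<notin> B \<and> insert i (B - {j}) \<notin> P")
    case True
    then have "A = insert i (B - {j})" using B by (simp add: shift_set_def)
    moreover have "insert j (insert i (B - {j}) - {i}) = B" using True by auto
    ultimately show ?thesis using that(2) B(1) by auto
  next
    case False
    then show ?thesis using that(1) B by (auto simp: shift_set_def)
  qed
qed

text \<open>Two moved sets share \<open>i\<close>, so only an unmoved \<open>A\<close> against a
  moved \<open>B\<close> needs care. If \<open>A\<close> was blocked, its exchange meets the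
  preimage of \<open>B\<close> in a point other than \<open>i\<close> and \<open>j\<close>.
  Otherwise \<open>A\<close> itself meets that preimage, and if it does so in \<open>j\<close>, then
  \<open>A\<close> and \<open>B\<close> share \<open>i\<close>.\<close>

lemma cross_intersecting_shift:
  assumes cr: "cross_intersecting P Q" and ij: "i \<noteq> j"
  shows "cross_intersecting (shift i j P) (shift i j Q)"
proof -
  have aux: "A \<inter> B \<noteq> {}"
    if "cross_intersecting P Q" "A \<in> P" "j \<in> A \<Longrightarrow> i \<notin> A \<Longrightarrow> insert i (A - {j}) \<in> P"
      "i \<in> B" "insert j (B - {i}) \<in> Q" for A B P Q
  proof (cases "j \<in> A \<and> i \<notin> A")
    case True
    then have "insert i (A - {j}) \<inter> insert j (B - {i}) \<noteq> {}"
      using that unfolding cross_intersecting_def by blast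
    then show ?thesis using ij by auto
  next
    case False
    have "A \<inter> insert j (B - {i}) \<noteq> {}"
      using that unfolding cross_intersecting_def by blast
    then show ?thesis using False that(4) by auto
  qed
  have cr': "cross_intersecting Q P" using cr by (auto simp: cross_intersecting_def Int_commute)
  show ?thesis unfolding cross_intersecting_def
  proof (intro ballI)
    fix A B assume A: "A \<in> shift i j P" and B: "B \<in> shift i j Q"
    from A show "A \<inter> B \<noteq> {}"
    proof (cases rule: mem_shift_cases)
      case 1
      note A1 = 1
      from B show ?thesis
      proof (cases rule: mem_shift_cases)
        case 1
        then show ?thesis using A1 cr by (auto simp: cross_intersecting_def)
      next
        case 2
        then show ?thesis using aux[OF cr A1] by blast
      qed
    next
      case 2
      note A2 = 2
      from B show ?thesis
      proof (cases rule: mem_shift_cases)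
        case 1
        then show ?thesis using aux[OF cr' 1 A2] by blast
      next
        case 2
        then show ?thesis using A2 by blast
      qed
    qed
  qed
qed

section \<open>Existence of shifted families by minimising total weight\<close>

definition weight :: "nat set set \<Rightarrow> nat" where
  "weight P = (\<Sum>A\<in>P. \<Sum>A)"

lemma weight_shift:
  assumes "finite P" "\<And>A. A \<in> P \<Longrightarrow> finite A" "i < j"
  shows "weight (shift i j P) \<le> weight P"
    and "\<not> shift i j P = P \<Longrightarrow> weight (shift i j P) < weight P"
proof -
  have sum_insert: "\<Sum>(insert i (A - {j})) < \<Sum>A" if "finite A" "j \<in> A" "i \<notin> A" for A
  proof -
    have "\<Sum>(insert i (A - {j})) = i + \<Sum>(A - {j})" using that by simp
    moreover have "\<Sum>A = j + \<Sum>(A - {j})" by (rule sum.remove) (use that in auto)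
    ultimately show ?thesis using assms(3) by linarith
  qed
  have le: "\<Sum>(shift_set i j P A) \<le> \<Sum>A" if "A \<in> P" for A
    using sum_insert[of A] assms(2)[OF that] by (auto simp: shift_set_def)
  have eq: "weight (shift i j P) = (\<Sum>A\<in>P. \<Sum>(shift_set i j P A))"
    unfolding weight_def shift_def by (simp add: sum.reindex inj_on_shift_set)
  show "weight (shift i j P) \<le> weight P"
    unfolding eq weight_def[of P] using le by (rule sum_mono)
  assume "\<not> shift i j P = P"
  then have "\<exists>A\<in>P. shift_set i j P A \<noteq> A" by (force simp: shift_def)
  then obtain A where A: "A \<in> P" "shift_set i j P A \<noteq> A" by blast
  have "\<Sum>(shift_set i j P A) < \<Sum>A"
    using sum_insert[of A] assms(2)[OF A(1)] A(2) by (auto simp: shift_set_def split: if_splits)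
  then show "weight (shift i j P) < weight P"
    unfolding eq weight_def[of P] using le A(1) assms(1) by (intro sum_strict_mono_ex1) auto
qed

lemma shiftedI:
  assumes "\<And>i j. i \<in> X \<Longrightarrow> j \<in> X \<Longrightarrow> i < j \<Longrightarrow> shift i j P = P"
  shows "shifted X P"
  unfolding shifted_def
proof (intro ballI impI)
  fix A i j assume H: "A \<in> P" "i \<in> X" "j \<in> X" "i < j \<and> j \<in> A \<and> i \<notin> A"
  show "insert i (A - {j}) \<in> P"
  proof (rule ccontr)
    assume n: "insert i (A - {j}) \<notin> P"
    then have "shift_set i j P A = insert i (A - {j})" using H by (simp add: shift_set_def)
    then have "insert i (A - {j}) \<in> shift i j P" using H by (force simp: shift_def)
    then show False using n assms[of i j] H by simp
  qed
qed

lemma shiftedD: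
  "shifted X P \<Longrightarrow> A \<in> P \<Longrightarrow> i \<in> X \<Longrightarrow> j \<in> X \<Longrightarrow> i < j \<Longrightarrow> j \<in> A \<Longrightarrow> i \<notin> A \<Longrightarrow> insert i (A - {j}) \<in> P"
  unfolding shifted_def by blast

text \<open>Among all admissible pairs of the given sizes, take one of least total weight. Applying
  the same shift to both families keeps the pair admissible and never raises either weight, so by
  minimality both families are fixed.\<close>

lemma shifted_cross_intersecting_pair:
  assumes X: "finite X" and PQ: "P \<subseteq> nsets X k" "Q \<subseteq> nsets X k" "cross_intersecting P Q"
  obtains P' Q' where "P' \<subseteq> nsets X k" "Q' \<subseteq> nsets X k" "cross_intersecting P' Q'"
    "card P' = card P" "card Q' = card Q" "shifted X P'" "shifted X Q'"
proof -
  define ok where "ok R \<longleftrightarrow> fst R \<subseteq> nsets X k \<and> snd R \<subseteq> nsets X k \<and>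
    cross_intersecting (fst R) (snd R) \<and> card (fst R) = card P \<and> card (snd R) = card Q" for R
  have "ok (P, Q)" using PQ by (simp add: ok_def)
  then obtain R where R: "ok R"
    and min: "\<And>R'. ok R' \<Longrightarrow> weight (fst R) + weight (snd R) \<le> weight (fst R') + weight (snd R')"
    using ex_has_least_nat[of ok "(P, Q)" "\<lambda>R. weight (fst R) + weight (snd R)"] by metis
  have fin: "finite (fst R)" "finite (snd R)" "\<And>A. A \<in> fst R \<union> snd R \<Longrightarrow> finite A"
    using R X by (auto simp: ok_def finite_imp_finite_nsets nsets_def intro: finite_subset)
  have "shift i j (fst R) = fst R \<and> shift i j (snd R) = snd R"
    if ij: "i \<in> X" "j \<in> X" "i < j" for i j
  proof -
    have "ok (shift i j (fst R), shift i j (snd R))"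
      using R ij shift_subset_nsets[of _ X k i j] cross_intersecting_shift[of _ _ i j]
      by (simp add: ok_def card_shift)
    from min[OF this] have
      "weight (fst R) + weight (snd R) \<le> weight (shift i j (fst R)) + weight (shift i j (snd R))"
      by simp
    moreover have "weight (shift i j S) \<le> weight S"
      "\<not> shift i j S = S \<Longrightarrow> weight (shift i j S) < weight S" if "S = fst R \<or> S = snd R" for S
      using weight_shift[of S i j] fin ij(3) that by blast+
    ultimately show ?thesis by (metis add_le_less_mono add_less_le_mono not_le)
  qed
  then have sh: "shifted X (fst R)" "shifted X (snd R)" by (auto intro: shiftedI)
  show thesis by (rule that[of "fst R" "snd R"]) (use R sh in \<open>simp_all add: ok_def\<close>)
qed

section \<open>Cross-intersecting and 2-intersecting families\<close>

definition link :: "'a \<Rightarrow> 'a set set \<Rightarrow> 'a set set" where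
  "link x P = {A. x \<notin> A \<and> insert x A \<in> P}"

definition avoiding :: "'a \<Rightarrow> 'a set set \<Rightarrow> 'a set set" where
  "avoiding x P = {A\<in>P. x \<notin> A}"

lemma card_link: "card (link x P) = card {A\<in>P. x \<in> A}"
  by (rule bij_betw_same_card[of "insert x"], rule bij_betwI[where g = "\<lambda>A. A - {x}"])
     (auto simp: link_def insert_absorb)

lemma card_link_avoiding: "finite P \<Longrightarrow> card P = card (link x P) + card (avoiding x P)"
  unfolding card_link avoiding_def by (subst card_Un_disjoint[symmetric]) (auto intro: arg_cong[where f = card])

lemma link_subset_nsets:
  assumes "P \<subseteq> nsets X k"
  shows "link x P \<subseteq> nsets (X - {x}) (k - 1)"
proof
  fix A assume "A \<in> link x P"
  then have "x \<notin> A" "insert x A \<in> nsets X k" using assms by (auto simp: link_def)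
  then show "A \<in> nsets (X - {x}) (k - 1)" by (auto simp: nsets_def)
qed

lemma avoiding_subset_nsets: "P \<subseteq> nsets X k \<Longrightarrow> avoiding x P \<subseteq> nsets (X - {x}) k"
  by (auto simp: avoiding_def nsets_def)

lemma shifted_avoiding: "shifted X P \<Longrightarrow> shifted (X - {x}) (avoiding x P)"
  unfolding shifted_def avoiding_def by simp

lemma shifted_link:
  assumes "shifted X P"
  shows "shifted (X - {x}) (link x P)"
  unfolding shifted_def link_def
proof (intro ballI impI)
  fix A i j assume H: "A \<in> {A. x \<notin> A \<and> insert x A \<in> P}" "i \<in> X - {x}" "j \<in> X - {x}"
    "i < j \<and> j \<in> A \<and> i \<notin> A"
  then have "insert i (insert x A - {j}) \<in> P" by (intro shiftedD[OF assms]) auto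
  moreover have "insert i (insert x A - {j}) = insert x (insert i (A - {j}))" using H by auto
  ultimately show "insert i (A - {j}) \<in> {A. x \<notin> A \<and> insert x A \<in> P}" using H by auto
qed

text \<open>A member containing the maximum omits some smaller point, for which the maximum can be
  exchanged.\<close>

lemma shifted_avoiding_Max_nonempty:
  assumes "finite X" "P \<subseteq> nsets X k" "P \<noteq> {}" "shifted X P" "k < card X"
  shows "avoiding (Max X) P \<noteq> {}"
proof -
  obtain A where A: "A \<in> P" using assms(3) by blast
  then have A': "A \<subseteq> X" "card A = k" "finite A" using assms(2) by (auto simp: nsets_def)
  show ?thesis
  proof (cases "Max X \<in> A")
    case True
    have "A \<noteq> X" using A' assms(5) by auto
    then obtain i where i: "i \<in> X" "i \<notin> A" using A' by blast
    then have "i < Max X" using True assms(1) by (metis Max_ge le_neq_implies_less)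
    then have "insert i (A - {Max X}) \<in> P"
      using shiftedD[OF assms(4) A i(1) _ _ True i(2)] assms(1) i(1) A'(1) True by blast
    then show ?thesis using \<open>i < Max X\<close> by (auto simp: avoiding_def)
  qed (use A in \<open>auto simp: avoiding_def\<close>)
qed

text \<open>No \<open>q\<close>-subset of \<open>Y - B\<close> can belong to
  \<open>R\<close>.\<close>

lemma card_meeting_le:
  assumes "finite Y" "R \<subseteq> nsets Y q" "B \<subseteq> Y" "\<And>A. A \<in> R \<Longrightarrow> A \<inter> B \<noteq> {}"
  shows "card R + ((card Y - card B) choose q) \<le> card Y choose q"
proof -
  have "R \<inter> nsets (Y - B) q = {}" using assms(4) by (fastforce simp: nsets_def)
  then have "card R + card (nsets (Y - B) q) = card (R \<union> nsets (Y - B) q)"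
    using assms by (intro card_Un_disjoint[symmetric])
      (auto intro: finite_subset simp: finite_imp_finite_nsets)
  also have "\<dots> \<le> card (nsets Y q)"
    using assms by (intro card_mono) (auto simp: finite_imp_finite_nsets nsets_def)
  finally show ?thesis using assms by (simp add: card_nsets card_Diff_subset finite_subset)
qed

lemma cross_intersecting_link_Max:
  assumes X: "finite X" "P \<subseteq> nsets X r" "Q \<subseteq> nsets X r" "shifted X P" "cross_intersecting P Q"
    and r: "2 * r \<le> card X"
  shows "cross_intersecting (link (Max X) P) (link (Max X) Q)"
  unfolding cross_intersecting_def
proof (intro ballI notI)
  let ?m = "Max X"
  fix A B assume A: "A \<in> link ?m P" and B: "B \<in> link ?m Q" and dis: "A \<inter> B = {}"
  have A': "insert ?m A \<in> P" "?m \<notin> A" "insert ?m A \<subseteq> X" "card (insert ?m A) = r" "finite A"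
    and B': "insert ?m B \<in> Q" "?m \<notin> B" "insert ?m B \<subseteq> X" "card (insert ?m B) = r" "finite B"
    using A B X by (auto simp: link_def nsets_def)
  \<comment> \<open>Disjoint \<open>A\<close> and \<open>B\<close> together with the maximum occupy
    \<open>2 * r - 1\<close> points, which leaves a free \<open>p\<close>. Exchanging the maximum
    for \<open>p\<close> in the set from \<open>P\<close> separates it from the set from
    \<open>Q\<close>.\<close>
  have "card (insert ?m (A \<union> B)) < card X"
    using A' B' r card_Un_disjoint[OF A'(5) B'(5) dis] by simp
  then have "insert ?m (A \<union> B) \<noteq> X" by auto
  then obtain p where p: "p \<in> X" "p \<noteq> ?m" "p \<notin> A" "p \<notin> B" using A' B' by blast
  then have "p < ?m" using X(1) by (metis Max_ge le_neq_implies_less)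
  then have "insert p (insert ?m A - {?m}) \<in> P"
    using A' p by (intro shiftedD[OF X(4) A'(1) p(1)]) auto
  then have "insert p (insert ?m A - {?m}) \<inter> insert ?m B \<noteq> {}"
    using B'(1) X(5) unfolding cross_intersecting_def by blast
  then show False using p dis A' B' by auto
qed

text \<open>
  Induction on the ground set, splitting off its maximum \<open>m\<close>: shiftedness makes the links at \<open>m\<close>
  cross-intersecting as well, because \<open>m\<close> can be exchanged for a point outside both sets.
\<close>

lemma shifted_cross_intersecting_bound:
  fixes X :: "nat set"
  assumes "finite X" "r \<ge> 1" "2 * r \<le> card X" "P \<subseteq> nsets X r" "Q \<subseteq> nsets X r"
    "P \<noteq> {}" "Q \<noteq> {}" "shifted X P" "shifted X Q" "cross_intersecting P Q"
  shows "card P + card Q + ((card X - r) choose r) \<le> (card X choose r) + 1"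
  using assms
proof (induction "card X" arbitrary: X r P Q rule: less_induct)
  case less
  note H = less.prems
  have fin: "finite P" "finite Q" using H finite_imp_finite_nsets finite_subset by metis+
  show ?case
  proof (cases "card X = 2 * r")
    \<comment> \<open>The complement of a member of \<open>Q\<close> is an \<open>r\<close>-set not
      in \<open>P\<close>, so both families together fit into \<open>nsets X r\<close>. The term
      \<open>(card X - r) choose r\<close> is 1 here and cancels the \<open>+ 1\<close>.\<close>
    case True
    have "(-) X ` Q \<subseteq> nsets X r"
      using H True by (auto simp: nsets_def card_Diff_subset)
    moreover have "P \<inter> (-) X ` Q = {}"
      using H(10) by (auto simp: cross_intersecting_def)
    moreover have "card ((-) X ` Q) = card Q"
      using H(5) by (intro card_image inj_onI) (auto simp: nsets_def)
    ultimately have "card P + card Q = card (P \<union> (-) X ` Q)" "P \<union> (-) X ` Q \<subseteq> nsets X r"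
      using card_Un_disjoint[of P "(-) X ` Q"] fin H(4) by auto
    then have "card P + card Q \<le> card (nsets X r)"
      using card_mono[OF finite_imp_finite_nsets[OF H(1)]] by metis
    then show ?thesis using H True by (simp add: card_nsets)
  next
    case False
    then have big: "2 * r < card X" using H(3) by simp
    let ?m = "Max X" and ?n = "card X - 1"
    let ?Y = "X - {?m}"
    have m: "?m \<in> X" using H(1) big by (intro Max_in) auto
    have cY: "card ?Y = ?n" "finite ?Y" "card ?Y < card X" using m H(1) big by auto
    have av: "avoiding ?m P \<noteq> {}" "avoiding ?m Q \<noteq> {}"
      using shifted_avoiding_Max_nonempty[OF H(1)] H big by auto
    have "cross_intersecting (avoiding ?m P) (avoiding ?m Q)"
      using H(10) by (auto simp: cross_intersecting_def avoiding_def)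
    then have IH1: "card (avoiding ?m P) + card (avoiding ?m Q) + ((?n - r) choose r) \<le> (?n choose r) + 1"
      using less.hyps[of ?Y r "avoiding ?m P" "avoiding ?m Q"] cY big av H
      by (simp add: avoiding_subset_nsets shifted_avoiding)
    have pascal: "card X choose r = (?n choose (r - 1)) + (?n choose r)"
      "(card X - r) choose r = ((?n - r) choose (r - 1)) + ((?n - r) choose r)"
      using choose_reduce_nat[of "card X" r] choose_reduce_nat[of "card X - r" r] H(2) big by auto
    have crl: "cross_intersecting (link ?m P) (link ?m Q)"
      using cross_intersecting_link_Max[of X P r Q] H by blast
    \<comment> \<open>The \<open>+ 1\<close> is already spent on the deletions, so the links need
      the bound without it. If one link is empty, all members of the other meet a fixed set avoiding
      the maximum. If neither is, Pascal's rule applied to the subtracted binomial yields a spare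
      term of at least 1.\<close>
    have "card (link ?m P) + card (link ?m Q) + ((?n - r) choose (r - 1)) \<le> ?n choose (r - 1)"
    proof -
      have one: "card R + ((?n - r) choose (r - 1)) \<le> ?n choose (r - 1)"
        if S: "S \<subseteq> nsets X r" "avoiding ?m S \<noteq> {}" and R: "R = link ?m P'" "P' \<subseteq> nsets X r"
          and cr: "cross_intersecting P' S" for R P' S
      proof -
        obtain B where B: "B \<in> S" "?m \<notin> B" using S(2) by (auto simp: avoiding_def)
        have "B \<subseteq> ?Y" "card B = r" using B S(1) by (auto simp: nsets_def)
        moreover have "A \<inter> B \<noteq> {}" if "A \<in> R" for A
          using that cr B R(1) by (fastforce simp: cross_intersecting_def link_def)
        ultimately show ?thesis
          using card_meeting_le[of ?Y R "r - 1" B] cY R link_subset_nsets[OF R(2), of ?m] by simp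
      qed
      have cr': "cross_intersecting Q P" using H(10) by (auto simp: cross_intersecting_def Int_commute)
      consider "link ?m Q = {}" | "link ?m P = {}" | "link ?m P \<noteq> {}" "link ?m Q \<noteq> {}" by auto
      then show ?thesis
      proof cases
        case 1
        then show ?thesis using one[OF H(5) av(2) refl H(4,10)] by simp
      next
        case 2
        then show ?thesis using one[OF H(4) av(1) refl H(5) cr'] by simp
      next
        case 3
        \<comment> \<open>For \<open>r = 1\<close> both links would contain the empty set, which is
          disjoint from itself.\<close>
        have r: "r - 1 \<ge> 1"
        proof (rule ccontr)
          assume "\<not> ?thesis"
          then have "link ?m P \<subseteq> nsets ?Y 0" "link ?m Q \<subseteq> nsets ?Y 0"
            using H link_subset_nsets[of _ X r ?m] by (metis (no_types) less_one not_le)+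
          then have "{} \<in> link ?m P" "{} \<in> link ?m Q" using 3 by auto
          then show False using crl by (auto simp: cross_intersecting_def)
        qed
        have "card (link ?m P) + card (link ?m Q) + ((?n - (r - 1)) choose (r - 1))
            \<le> (?n choose (r - 1)) + 1"
          using less.hyps[OF cY(3,2) r _ link_subset_nsets[OF H(4)] link_subset_nsets[OF H(5)] 3
              shifted_link[OF H(8)] shifted_link[OF H(9)] crl] cY(1) big by simp
        moreover have "(?n - (r - 1)) choose (r - 1) = ((?n - r) choose (r - 2)) + ((?n - r) choose (r - 1))"
          using choose_reduce_nat[of "?n - (r - 1)" "r - 1"] r big
          by (simp add: numeral_2_eq_2)
        moreover have "(?n - r) choose (r - 2) \<ge> 1"
          using big by (simp add: Suc_le_eq)
        ultimately show ?thesis by linarith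
      qed
    qed
    then show ?thesis
      using IH1 pascal card_link_avoiding[OF fin(1), of ?m] card_link_avoiding[OF fin(2), of ?m]
      by linarith
  qed
qed

text \<open>The Hilton-Milner bound for a nonempty cross-intersecting pair; it is attained by a
  single \<open>r\<close>-set and all \<open>r\<close>-sets meeting it.\<close>

lemma cross_intersecting_bound:
  fixes X :: "nat set"
  assumes "finite X" "r \<ge> 1" "2 * r \<le> card X" "P \<subseteq> nsets X r" "Q \<subseteq> nsets X r"
    "P \<noteq> {}" "Q \<noteq> {}" "cross_intersecting P Q"
  shows "card P + card Q + ((card X - r) choose r) \<le> (card X choose r) + 1"
proof -
  obtain P' Q' where PQ: "P' \<subseteq> nsets X r" "Q' \<subseteq> nsets X r" "cross_intersecting P' Q'"
    "card P' = card P" "card Q' = card Q" "shifted X P'" "shifted X Q'"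
    using shifted_cross_intersecting_pair[OF assms(1,4,5,8)] by blast
  have "finite P" "finite Q" using assms finite_imp_finite_nsets finite_subset by metis+
  then have "P' \<noteq> {}" "Q' \<noteq> {}" using PQ(4,5) assms(6,7) by force+
  then show ?thesis
    using shifted_cross_intersecting_bound[OF assms(1-3) PQ(1,2) _ _ PQ(6,7,3)] PQ(4,5) by simp
qed

text \<open>Again an induction splitting off the maximum. Shiftedness keeps the link 2-intersecting,
  and Pascal's rule adds up the bounds for link and deletion.\<close>

lemma shifted_2_intersecting_bound:
  fixes X :: "nat set"
  assumes "finite X" "k \<ge> 2" "2 * k \<le> card X + 2" "P \<subseteq> nsets X k" "shifted X P"
    "\<And>A B. A \<in> P \<Longrightarrow> B \<in> P \<Longrightarrow> card (A \<inter> B) \<ge> 2"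
  shows "card P \<le> card X choose (k - 2)"
  using assms
proof (induction "card X" arbitrary: X k P rule: less_induct)
  case less
  note H = less.prems
  have fin: "finite P" using H finite_imp_finite_nsets finite_subset by metis
  have le: "card P \<le> card X choose k"
    using card_mono[OF _ H(4)] H(1) by (simp add: card_nsets finite_imp_finite_nsets)
  show ?case
  proof (cases "card X + 2 = 2 * k")
    \<comment> \<open>Here \<open>card X = 2 * k - 2\<close>, so \<open>k\<close>-sets and
      \<open>(k - 2)\<close>-sets are equally numerous and the trivial bound suffices.\<close>
    case True
    then have "card X - k = k - 2" "k \<le> card X" using H(2) by auto
    then have "card X choose k = card X choose (k - 2)"
      using binomial_symmetric[of k "card X"] by simp
    then show ?thesis using le by simp
  next
    case False
    then have big: "2 * k < card X + 2" using H(3) by simp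
    show ?thesis
    proof (cases "k = 2")
      case True
      have "A = B" if "A \<in> P" "B \<in> P" for A B
      proof -
        have c: "finite A" "card A = 2" "finite B" "card B = 2"
          using H(4) that True by (auto simp: nsets_def)
        then have "A \<inter> B = A" "A \<inter> B = B"
          using H(6)[OF that] card_seteq[of A "A \<inter> B"] card_seteq[of B "A \<inter> B"] by auto
        then show ?thesis by simp
      qed
      then have "card P \<le> Suc 0" using fin by (subst card_le_Suc0_iff_eq) auto
      then show ?thesis using True by simp
    next
      case False
      let ?m = "Max X" and ?n = "card X - 1"
      let ?Y = "X - {?m}"
      have m: "?m \<in> X" using H(1,2) big by (intro Max_in) auto
      have cY: "card ?Y = ?n" "finite ?Y" "card ?Y < card X"
        using m H(1,2) big by auto
      have IH1: "card (avoiding ?m P) \<le> ?n choose (k - 2)"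
        using less.hyps[of ?Y k "avoiding ?m P"] cY big H
        by (simp add: avoiding_subset_nsets shifted_avoiding) (simp add: avoiding_def)
      have two: "card (A \<inter> B) \<ge> 2" if A: "A \<in> link ?m P" and B: "B \<in> link ?m P" for A B
      proof (rule ccontr)
        assume small: "\<not> ?thesis"
        have A': "insert ?m A \<in> P" "?m \<notin> A" "insert ?m A \<subseteq> X" "card (insert ?m A) = k" "finite A"
          and B': "insert ?m B \<in> P" "?m \<notin> B" "insert ?m B \<subseteq> X" "card (insert ?m B) = k" "finite B"
          using A B H(4) by (auto simp: link_def nsets_def)
        have "card (insert ?m A \<inter> insert ?m B) \<ge> 2" using H(6) A' B' by blast
        moreover have "insert ?m A \<inter> insert ?m B = insert ?m (A \<inter> B)" by blast
        ultimately have c1: "card (A \<inter> B) = 1" using small A' by simp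
        \<comment> \<open>With one common point, the union and the maximum occupy
          \<open>2 * k - 2\<close> points. Moving the maximum of the first set to a free
          \<open>p\<close> leaves only that one common point, against the hypothesis.\<close>
        have "card (insert ?m (A \<union> B)) < card X"
          using A' B' c1 big card_Un_Int[OF A'(5) B'(5)] by simp
        then have "insert ?m (A \<union> B) \<noteq> X" by auto
        then obtain p where p: "p \<in> X" "p \<noteq> ?m" "p \<notin> A" "p \<notin> B" using A' B' by blast
        then have "p < ?m" using H(1) by (metis Max_ge le_neq_implies_less)
        then have "insert p (insert ?m A - {?m}) \<in> P"
          using A' p by (intro shiftedD[OF H(5) A'(1) p(1)]) auto
        then have "card (insert p (insert ?m A - {?m}) \<inter> insert ?m B) \<ge> 2" using H(6) B'(1) by blast
        moreover have "insert p (insert ?m A - {?m}) \<inter> insert ?m B = A \<inter> B"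
          using p A'(2) B'(2) by auto
        ultimately show False using c1 by simp
      qed
      have "card (link ?m P) \<le> card ?Y choose (k - 1 - 2)"
      proof (rule less.hyps[of ?Y])
        show "2 \<le> k - 1" "2 * (k - 1) \<le> card ?Y + 2" using cY big H(2) False by auto
        show "link ?m P \<subseteq> nsets ?Y (k - 1)" using H(4) by (rule link_subset_nsets)
        show "shifted ?Y (link ?m P)" using H(5) by (rule shifted_link)
      qed (use cY two in simp_all)
      moreover have "card X choose (k - 2) = (?n choose (k - 2 - 1)) + (?n choose (k - 2))"
        using choose_reduce_nat[of "card X" "k - 2"] False H(2) big by simp
      moreover have "k - 2 - 1 = k - 1 - 2" by simp
      ultimately show ?thesis using IH1 cY(1) card_link_avoiding[OF fin, of ?m] by simp
    qed
  qed
qed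

section \<open>A weak Hilton-Milner theorem\<close>

text \<open>\<open>F\<close> splits into the sets containing both \<open>i\<close> and
  \<open>j\<close>, only \<open>i\<close>, or only \<open>j\<close>. The last two classes, stripped
  of \<open>i\<close> and \<open>j\<close>, form a nonempty cross-intersecting pair of
  \<open>(k - 1)\<close>-sets; the first is bounded trivially, and Pascal's rule combines the
  bounds.\<close>

lemma two_covered_intersecting_bound:
  fixes X :: "nat set"
  assumes X: "finite X" and k: "k \<ge> 2" "2 * k \<le> card X"
    and F: "F \<subseteq> nsets X k" "cross_intersecting F F"
    and nonstar: "\<And>x. \<exists>A\<in>F. x \<notin> A"
    and ij: "i \<in> X" "j \<in> X" "i \<noteq> j" and cover: "\<And>A. A \<in> F \<Longrightarrow> i \<in> A \<or> j \<in> A"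
  shows "card F + ((card X - k - 1) choose (k - 1)) \<le> ((card X - 1) choose (k - 1)) + 1"
proof -
  let ?Y = "X - {i} - {j}"
  let ?P = "avoiding j (link i F)" and ?Q = "link j (avoiding i F)"
  have fF: "finite F" using F X finite_imp_finite_nsets finite_subset by metis
  have Y: "finite ?Y" "card ?Y = card X - 2" using X ij by auto
  have P: "?P \<subseteq> nsets ?Y (k - 1)" using F by (intro avoiding_subset_nsets link_subset_nsets)
  have "?Q \<subseteq> nsets (X - {i} - {j}) (k - 1)" using F by (intro avoiding_subset_nsets link_subset_nsets)
  have ne: "?P \<noteq> {}" "?Q \<noteq> {}"
  proof -
    obtain A where "A \<in> F" "j \<notin> A" using nonstar by blast
    then have "A - {i} \<in> ?P" using cover[of A] ij by (auto simp: avoiding_def link_def insert_absorb)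
    then show "?P \<noteq> {}" by blast
    obtain B where "B \<in> F" "i \<notin> B" using nonstar by blast
    then have "B - {j} \<in> ?Q" using cover[of B] ij by (auto simp: avoiding_def link_def insert_absorb)
    then show "?Q \<noteq> {}" by blast
  qed
  have "cross_intersecting ?P ?Q"
    unfolding cross_intersecting_def
  proof (intro ballI)
    fix A B assume A: "A \<in> ?P" and B: "B \<in> ?Q"
    then have "insert i A \<inter> insert j B \<noteq> {}"
      using F(2) unfolding cross_intersecting_def avoiding_def link_def by blast
    then show "A \<inter> B \<noteq> {}" using A B ij(3) by (auto simp: avoiding_def link_def)
  qed
  then have 1: "card ?P + card ?Q + ((card ?Y - (k - 1)) choose (k - 1)) \<le> (card ?Y choose (k - 1)) + 1"
    using Y k P \<open>?Q \<subseteq> _\<close> ne by (intro cross_intersecting_bound) auto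
  have "link j (link i F) \<subseteq> nsets ?Y (k - 1 - 1)" using F by (intro link_subset_nsets)
  from card_mono[OF finite_imp_finite_nsets[OF Y(1)] this]
  have 2: "card (link j (link i F)) \<le> card ?Y choose (k - 1 - 1)" using Y(1) by (simp add: card_nsets)
  have "finite (link i F)" "finite (avoiding i F)"
    using link_subset_nsets[OF F(1), of i] avoiding_subset_nsets[OF F(1), of i] X
      finite_imp_finite_nsets finite_subset by (metis finite_Diff)+
  moreover have "avoiding j (avoiding i F) = {}" using cover by (auto simp: avoiding_def)
  ultimately have "card F = card (link j (link i F)) + card ?P + card ?Q"
    using card_link_avoiding[OF fF, of i] card_link_avoiding[of "link i F" j]
      card_link_avoiding[of "avoiding i F" j] by simp
  moreover have "(card X - 1) choose (k - 1) = (card ?Y choose (k - 1 - 1)) + (card ?Y choose (k - 1))"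
    using choose_reduce_nat[of "card X - 1" "k - 1"] k Y(2) by (simp add: numeral_2_eq_2)
  moreover have "card ?Y - (k - 1) = card X - k - 1" using k Y(2) by simp
  ultimately show ?thesis using 1 2 by simp
qed

text \<open>Sets through 1 all meet a fixed member avoiding 1, while the sets avoiding 1 are
  2-intersecting. The sharp Hilton-Milner bound has 1 in place of the last binomial.\<close>

lemma shifted_intersecting_bound:
  assumes k: "k \<ge> 2" "2 * k \<le> n"
    and F: "F \<subseteq> nsets {1..n} k" "cross_intersecting F F" "shifted {1..n} F"
    and nonstar: "\<exists>A\<in>F. 1 \<notin> A"
  shows "card F + ((n - k - 1) choose (k - 1)) \<le> ((n - 1) choose (k - 1)) + ((n - 1) choose (k - 2))"
proof -
  let ?Y = "{1..n} - {1}"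
  have fF: "finite F" using F finite_imp_finite_nsets finite_subset by (metis finite_atLeastAtMost)
  have Y: "card ?Y = n - 1" using k by simp
  have "card (avoiding 1 F) \<le> card ?Y choose (k - 2)"
  proof (rule shifted_2_intersecting_bound)
    \<comment> \<open>if \<open>A\<close> and \<open>B\<close> met in a single point \<open>j\<close>, shifting \<open>j\<close> to \<open>1\<close> in \<open>A\<close> would separate them\<close>
    fix A B assume A: "A \<in> avoiding 1 F" and B: "B \<in> avoiding 1 F"
    have "A \<inter> B \<noteq> {}" using A B F(2) by (auto simp: avoiding_def cross_intersecting_def)
    then obtain j where j: "j \<in> A" "j \<in> B" by blast
    have A': "A \<in> nsets {1..n} k" "1 \<notin> A" using A F(1) by (auto simp: avoiding_def)
    then have fA: "finite A" and jn: "j \<in> {1..n}" using j by (auto simp: nsets_def)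
    have "1 < j" using jn A'(2) j(1) by (cases "j = 1") auto
    note jn = jn this
    have "insert 1 (A - {j}) \<in> F"
      using A j jn k by (intro shiftedD[OF F(3)]) (auto simp: avoiding_def)
    then have "insert 1 (A - {j}) \<inter> B \<noteq> {}"
      using B F(2) unfolding cross_intersecting_def avoiding_def by blast
    then obtain l where "l \<in> A" "l \<in> B" "l \<noteq> j" using B by (auto simp: avoiding_def)
    then have "card {j, l} \<le> card (A \<inter> B)" using j fA by (intro card_mono) auto
    then show "card (A \<inter> B) \<ge> 2" using \<open>l \<noteq> j\<close> by simp
  qed (use F k Y in \<open>simp_all add: avoiding_subset_nsets shifted_avoiding\<close>)
  moreover have "card (link 1 F) + ((n - k - 1) choose (k - 1)) \<le> (n - 1) choose (k - 1)"
  proof -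
    obtain B where B: "B \<in> F" "1 \<notin> B" using nonstar by blast
    then have "B \<subseteq> ?Y" "card B = k" using F(1) by (auto simp: nsets_def)
    moreover have "A \<inter> B \<noteq> {}" if "A \<in> link 1 F" for A
    proof -
      have "insert 1 A \<inter> B \<noteq> {}" using that B F(2) by (auto simp only: link_def cross_intersecting_def)
      then show ?thesis using B by auto
    qed
    moreover have "n - 1 - k = n - k - 1" by simp
    ultimately show ?thesis
      using card_meeting_le[of ?Y "link 1 F" "k - 1" B] Y link_subset_nsets[OF F(1), of 1] by simp
  qed
  ultimately show ?thesis using card_link_avoiding[OF fF, of 1] Y by simp
qed

text \<open>
  Among the non-star intersecting families of a given size, one of minimal weight is either shifted, or some shift turns it into a star,
  in which case the two points of that shift cover it.
\<close>

lemma nonstar_intersecting_bound: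
  assumes k: "k \<ge> 2" "2 * k \<le> n"
    and F: "F \<subseteq> nsets {1..n} k" "cross_intersecting F F" and nonstar: "\<And>x. \<exists>A\<in>F. x \<notin> A"
  shows "card F + ((n - k - 1) choose (k - 1)) \<le> ((n - 1) choose (k - 1)) + ((n - 1) choose (k - 2))"
proof -
  define ok where "ok G \<longleftrightarrow> G \<subseteq> nsets {1..n} k \<and> cross_intersecting G G \<and>
    (\<forall>x. \<exists>A\<in>G. x \<notin> A) \<and> card G = card F" for G
  have "ok F" using F nonstar by (simp add: ok_def)
  then obtain G where G: "ok G" and min: "\<And>H. ok H \<Longrightarrow> weight G \<le> weight H"
    using ex_has_least_nat[of ok F weight] by metis
  have G': "G \<subseteq> nsets {1..n} k" "cross_intersecting G G" "\<And>x. \<exists>A\<in>G. x \<notin> A" "card G = card F"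
    using G by (auto simp: ok_def)
  have fin: "finite G" "\<And>A. A \<in> G \<Longrightarrow> finite A"
    using G'(1) finite_subset[OF _ finite_imp_finite_nsets[of "{1..n}" k]] by (auto simp: nsets_def)
  show ?thesis
  proof (cases "\<exists>i\<in>{1..n}. \<exists>j\<in>{1..n}. i \<noteq> j \<and> (\<forall>A\<in>G. i \<in> A \<or> j \<in> A)")
    case True
    then obtain i j where "i \<in> {1..n}" "j \<in> {1..n}" "i \<noteq> j" "\<And>A. A \<in> G \<Longrightarrow> i \<in> A \<or> j \<in> A" by blast
    from two_covered_intersecting_bound[OF _ k(1) _ G'(1-3) this] k(2)
    have "card G + ((n - k - 1) choose (k - 1)) \<le> ((n - 1) choose (k - 1)) + 1" by simp
    moreover have "(n - 1) choose (k - 2) > 0" using k by simp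
    ultimately show ?thesis using G'(4) by linarith
  next
    case False
    have "shift i j G = G" if ij: "i \<in> {1..n}" "j \<in> {1..n}" "i < j" for i j
    proof -
      have "\<exists>A\<in>shift i j G. x \<notin> A" for x
      proof (rule ccontr)
        assume "\<not> ?thesis"
        then have star: "x \<in> shift_set i j G A" if "A \<in> G" for A using that by (auto simp: shift_def)
        obtain A where A: "A \<in> G" "x \<notin> A" using G'(3) by blast
        \<comment> \<open>A shift adds no point but \<open>i\<close>. If afterwards every set
          contains \<open>i\<close>, then every set contained \<open>i\<close> or \<open>j\<close>
          before, which this case excludes.\<close>
        then have "x = i" using star[OF A(1)] by (auto simp: shift_set_def split: if_splits)
        then have "i \<in> B \<or> j \<in> B" if "B \<in> G" for B
          using star[OF that] by (auto simp: shift_set_def split: if_splits)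
        moreover have "i \<noteq> j" using ij(3) by simp
        ultimately show False using False ij(1,2) by metis
      qed
      then have "ok (shift i j G)"
        using G' ij shift_subset_nsets[OF G'(1) ij(1), of j] cross_intersecting_shift[OF G'(2), of i j]
        by (simp add: ok_def card_shift)
      then show ?thesis using min[of "shift i j G"] weight_shift(2)[of G i j] fin ij(3) by (meson not_le)
    qed
    then have "shifted {1..n} G" by (auto intro: shiftedI)
    then show ?thesis using shifted_intersecting_bound[OF k G'(1,2)] G'(3,4) by metis
  qed
qed

text \<open>Pascal's rule used \<open>c\<close> times; each increment is at most the last
  one.\<close>

lemma choose_add_le: "b \<ge> 1 \<Longrightarrow> (a + c) choose b \<le> (a choose b) + c * ((a + c - 1) choose (b - 1))"
proof (induction c)
  case (Suc c)
  have "(a + Suc c) choose b = ((a + c) choose (b - 1)) + ((a + c) choose b)"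
    using choose_reduce_nat[of "a + Suc c" b] Suc.prems by simp
  moreover have "c * ((a + c - 1) choose (b - 1)) \<le> c * ((a + c) choose (b - 1))"
    by (intro mult_le_mono2 binomial_right_mono) auto
  moreover have "a + Suc c - 1 = a + c" by simp
  ultimately show ?case using Suc.IH[OF Suc.prems] by (simp only: mult_Suc)
qed simp

section \<open>Degrees and binomial estimates\<close>

text \<open>Any \<open>t\<close> common neighbours would have a union disjoint from that of
  \<open>F\<close>.\<close>

lemma card_common_neighbours_le:
  assumes "finite \<A>" "union_intersecting s t \<A>" "t \<ge> 1" "F \<in> nsets \<A> s"
  shows "card {B\<in>\<A>. \<forall>C\<in>F. B \<inter> C = {}} \<le> t - 1"
proof (rule ccontr)
  assume "\<not> ?thesis"
  then have "t \<le> card {B\<in>\<A>. \<forall>C\<in>F. B \<inter> C = {}}" by simp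
  then obtain G where G: "G \<subseteq> {B\<in>\<A>. \<forall>C\<in>F. B \<inter> C = {}}" "card G = t" "finite G"
    by (rule obtain_subset_with_card_n)
  then have "G \<in> nsets \<A> t" by (auto simp: nsets_def)
  then have "\<Union>F \<inter> \<Union>G \<noteq> {}" using assms(2,4) unfolding union_intersecting_def by blast
  then show False using G(1) by blast
qed

lemma card_nsets_containing_pair:
  assumes "finite X" "i \<in> X" "u \<in> X" "u \<noteq> i"
  shows "card {A\<in>nsets X k. i \<in> A \<and> u \<in> A} \<le> (card X - 2) choose (k - 2)"
proof -
  have "card {A\<in>nsets X k. i \<in> A \<and> u \<in> A} = card (link i {A\<in>nsets X k. u \<in> A})"
    unfolding card_link by (rule arg_cong[where f = card]) auto
  also have "link i {A\<in>nsets X k. u \<in> A} = {A\<in>link i (nsets X k). u \<in> A}"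
    using assms(4) by (auto simp: link_def)
  also have "card \<dots> = card (link u (link i (nsets X k)))" by (simp add: card_link)
  also have "\<dots> \<le> card (nsets (X - {i} - {u}) (k - 1 - 1))"
    using assms(1) by (intro card_mono finite_imp_finite_nsets link_subset_nsets) auto
  also have "\<dots> = (card X - 2) choose (k - 2)"
    using assms by (simp add: card_nsets numeral_2_eq_2)
  finally show ?thesis .
qed

text \<open>Fix \<open>s\<close> members avoiding \<open>i\<close>. A member through
  \<open>i\<close> is either one of their at most \<open>t - 1\<close> common neighbours or contains
  one of the at most \<open>s * k\<close> points of their union.\<close>

lemma degree_bound:
  assumes \<A>: "\<A> \<subseteq> nsets {1..n} k" "union_intersecting s t \<A>" and "t \<ge> 1" and i: "i \<in> {1..n}"
    and s: "s \<le> card (\<A> - star n k i)"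
  shows "card {A\<in>\<A>. i \<in> A} \<le> s * k * ((n - 2) choose (k - 2)) + (t - 1)"
proof -
  have f\<A>: "finite \<A>" using \<A>(1) finite_subset finite_imp_finite_nsets by (metis finite_atLeastAtMost)
  obtain F where F: "F \<subseteq> \<A> - star n k i" "card F = s" "finite F"
    using obtain_subset_with_card_n[OF s] by blast
  have iF: "i \<notin> \<Union>F" using F(1) \<A>(1) by (auto simp: star_def)
  have Fk: "finite C" "card C = k" "C \<subseteq> {1..n}" if "C \<in> F" for C
    using that F(1) \<A>(1) by (auto simp: nsets_def)
  have fU: "finite (\<Union>F)" using F(3) Fk by blast
  have "card (\<Union>F) \<le> (\<Sum>C\<in>F. card C)" by (rule card_Union_le_sum_card)
  then have cU: "card (\<Union>F) \<le> s * k" using Fk(2) F(2) by simp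
  have "{A\<in>\<A>. i \<in> A} \<subseteq> {B\<in>\<A>. \<forall>C\<in>F. B \<inter> C = {}} \<union> (\<Union>u\<in>\<Union>F. {A\<in>nsets {1..n} k. i \<in> A \<and> u \<in> A})"
  proof
    fix A assume A: "A \<in> {A\<in>\<A>. i \<in> A}"
    show "A \<in> {B\<in>\<A>. \<forall>C\<in>F. B \<inter> C = {}} \<union> (\<Union>u\<in>\<Union>F. {A\<in>nsets {1..n} k. i \<in> A \<and> u \<in> A})"
    proof (cases "\<forall>C\<in>F. A \<inter> C = {}")
      case False
      then obtain u where "u \<in> \<Union>F" "u \<in> A" by auto
      then show ?thesis using A \<A>(1) by auto
    qed (use A in simp)
  qed
  then have "card {A\<in>\<A>. i \<in> A} \<le>
      card ({B\<in>\<A>. \<forall>C\<in>F. B \<inter> C = {}} \<union> (\<Union>u\<in>\<Union>F. {A\<in>nsets {1..n} k. i \<in> A \<and> u \<in> A}))"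
    using f\<A> by (intro card_mono finite_UnI finite_UN_I[OF fU]) (simp_all add: finite_imp_finite_nsets)
  also have "\<dots> \<le> card {B\<in>\<A>. \<forall>C\<in>F. B \<inter> C = {}} + card (\<Union>u\<in>\<Union>F. {A\<in>nsets {1..n} k. i \<in> A \<and> u \<in> A})"
    by (rule card_Un_le)
  also have "card {B\<in>\<A>. \<forall>C\<in>F. B \<inter> C = {}} \<le> t - 1"
    using F by (intro card_common_neighbours_le[OF f\<A> \<A>(2) assms(3)]) (auto simp: nsets_def)
  also have "card (\<Union>u\<in>\<Union>F. {A\<in>nsets {1..n} k. i \<in> A \<and> u \<in> A})
      \<le> (\<Sum>u\<in>\<Union>F. card {A\<in>nsets {1..n} k. i \<in> A \<and> u \<in> A})"
    by (rule card_UN_le[OF fU])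
  also have "\<dots> \<le> (\<Sum>u\<in>\<Union>F. (n - 2) choose (k - 2))"
  proof (rule sum_mono)
    fix u assume "u \<in> \<Union>F"
    then have "u \<in> {1..n}" "u \<noteq> i" using Fk(3) iF by blast+
    then show "card {A\<in>nsets {1..n} k. i \<in> A \<and> u \<in> A} \<le> (n - 2) choose (k - 2)"
      using card_nsets_containing_pair[of "{1..n}" i u k] i by simp
  qed
  also have "(\<Sum>u\<in>\<Union>F. (n - 2) choose (k - 2)) \<le> s * k * ((n - 2) choose (k - 2))"
    using cU by simp
  finally show ?thesis by simp
qed

lemma card_star: "i \<in> {1..n} \<Longrightarrow> k \<ge> 1 \<Longrightarrow> card (star n k i) = (n - 1) choose (k - 1)"
proof -
  assume i: "i \<in> {1..n}" and k: "k \<ge> 1"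
  have "star n k i = {A\<in>nsets {1..n} k. i \<in> A}" by (simp add: star_def)
  then have "card (star n k i) = card (link i (nsets {1..n} k))" by (simp add: card_link)
  also have "link i (nsets {1..n} k) = nsets ({1..n} - {i}) (k - 1)"
  proof
    show "link i (nsets {1..n} k) \<subseteq> nsets ({1..n} - {i}) (k - 1)" by (rule link_subset_nsets) simp
    show "nsets ({1..n} - {i}) (k - 1) \<subseteq> link i (nsets {1..n} k)"
    proof
      fix A assume "A \<in> nsets ({1..n} - {i}) (k - 1)"
      then have A: "A \<subseteq> {1..n}" "i \<notin> A" "finite A" "card A = k - 1" by (auto simp: nsets_def)
      then have "card (insert i A) = k" using k by simp
      then show "A \<in> link i (nsets {1..n} k)" using A i by (simp add: link_def nsets_def)
    qed
  qed
  finally show ?thesis using i by (simp add: card_nsets)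
qed

text \<open>Division-free forms of the ratios \<open>(k - 1) / (n - 1)\<close> and
  \<open>(k - 1) / (n - k + 1)\<close> to \<open>(n - 1) choose (k - 1)\<close>.\<close>

lemma binomial_neighbour_identities:
  assumes "k \<ge> 2" "k \<le> n"
  shows "(real n - 1) * real ((n - 2) choose (k - 2)) = (real k - 1) * real ((n - 1) choose (k - 1))"
    and "(real n - real k + 1) * real ((n - 1) choose (k - 2)) = (real k - 1) * real ((n - 1) choose (k - 1))"
proof -
  define j m where "j = k - 2" and "m = n - 2"
  then have j: "k = Suc (Suc j)" and m: "n = Suc (Suc m)" using assms by auto
  have 1: "Suc j * (Suc m choose Suc j) = Suc m * (m choose j)" by (rule Suc_times_binomial)
  have 2: "(Suc m - j) * (Suc m choose j) = Suc m * (m choose j)"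
    using binomial_absorb_comp[of "Suc m" j] by simp
  have 3: "real (Suc m - j) = real n - real k + 1" "real (Suc m) = real n - 1" "real (Suc j) = real k - 1"
    using assms by (simp_all add: j m of_nat_diff)
  have 4: "n - 2 = m" "k - 2 = j" "n - 1 = Suc m" "k - 1 = Suc j" by (simp_all add: j m)
  show "(real n - 1) * real ((n - 2) choose (k - 2)) = (real k - 1) * real ((n - 1) choose (k - 1))"
    unfolding 4 using 1 3 by (metis of_nat_mult)
  show "(real n - real k + 1) * real ((n - 1) choose (k - 2)) = (real k - 1) * real ((n - 1) choose (k - 1))"
    unfolding 4 using 1 2 3 by (metis of_nat_mult)
qed

text \<open>The bound for non-stars leaves two terms: \<open>k * ((n - 2) choose (k - 2))\<close>,
  at most half of the star size, and \<open>(n - 1) choose (k - 2)\<close>, less than the fraction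
  \<open>1 / c\<close> of it. The parameter \<open>c\<close> stays free because \<open>t = 1\<close>
  and larger \<open>t\<close> call for different values.\<close>

lemma nonstar_intersecting_fraction:
  assumes k: "k \<ge> 2" "2 * k \<le> n"
    and F: "F \<subseteq> nsets {1..n} k" "cross_intersecting F F" and nonstar: "\<And>x. \<exists>A\<in>F. x \<notin> A"
    and n: "2 * (real k * (real k - 1)) \<le> real n - 1"
    and c: "c > 0" "c * (real k - 1) < real n - real k + 1"
  shows "real (card F) < (1 / 2 + 1 / c) * real ((n - 1) choose (k - 1))"
proof -
  let ?M = "(n - 1) choose (k - 1)"
  have M: "real ?M > 0" using k by simp
  have "(n - 1) choose (k - 1) \<le> ((n - k - 1) choose (k - 1)) + k * ((n - 2) choose (k - 2))"
    using choose_add_le[of "k - 1" "n - k - 1" k] k by (simp add: numeral_2_eq_2)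
  then have "card F \<le> k * ((n - 2) choose (k - 2)) + ((n - 1) choose (k - 2))"
    using nonstar_intersecting_bound[OF k F nonstar] by linarith
  then have le: "real (card F) \<le> real k * real ((n - 2) choose (k - 2)) + real ((n - 1) choose (k - 2))"
    by (metis of_nat_add of_nat_le_iff of_nat_mult)
  have n1: "real n - 1 > 0" using k by simp
  have "real k * real ((n - 2) choose (k - 2)) * (real n - 1) = real k * (real k - 1) * real ?M"
    using binomial_neighbour_identities(1)[of k n] k by (metis (no_types) add_leD1 mult.assoc mult.commute mult_2)
  also have "\<dots> \<le> (real n - 1) / 2 * real ?M" using n M by (intro mult_right_mono) auto
  finally have "real k * real ((n - 2) choose (k - 2)) * (real n - 1) \<le> real ?M / 2 * (real n - 1)"
    by (simp add: mult.commute)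
  then have 1: "real k * real ((n - 2) choose (k - 2)) \<le> real ?M / 2"
    using n1 by (rule mult_right_le_imp_le)
  have "c * ((real k - 1) * real ?M) < (real n - real k + 1) * real ?M"
    using mult_strict_right_mono[OF c(2) M] by (simp add: mult.assoc)
  then have "(real n - real k + 1) * (c * real ((n - 1) choose (k - 2))) < (real n - real k + 1) * real ?M"
    using binomial_neighbour_identities(2)[of k n] k by (metis add_leD1 mult.left_commute mult_2)
  moreover have "real n - real k + 1 > 0" using k by simp
  ultimately have "c * real ((n - 1) choose (k - 2)) < real ?M"
    by (simp only: mult_less_cancel_left_pos)
  then have 2: "real ((n - 1) choose (k - 2)) < 1 / c * real ?M" using c(1) by (simp add: field_simps)
  show ?thesis using le 1 2 by (simp add: algebra_simps)
qed

text \<open>The central binomial is the sum of two entries of row \<open>2 * k - 1\<close>, whose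
  total is \<open>2 ^ (2 * k - 1)\<close>.\<close>

lemma central_binomial_le: "k \<ge> 1 \<Longrightarrow> 2 * ((2 * k) choose k) \<le> 4 ^ k"
proof -
  assume "k \<ge> 1"
  then obtain j where j: "k = Suc j" by (metis Suc_le_D One_nat_def)
  have "(2 * k) choose k = ((2 * j + 1) choose j) + ((2 * j + 1) choose Suc j)"
    by (simp add: j)
  also have "\<dots> = (\<Sum>i\<in>{j, Suc j}. (2 * j + 1) choose i)" by simp
  also have "\<dots> \<le> (\<Sum>i\<le>2 * j + 1. (2 * j + 1) choose i)" by (intro sum_mono2) auto
  also have "\<dots> = 2 ^ (2 * j + 1)" by (rule choose_row_sum)
  finally show ?thesis by (simp add: j power_mult)
qed

text \<open>The exponent of 2 times \<open>k - 1\<close> equals \<open>s * (2 * k + 1)\<close>, so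
  the \<open>(k - 1)\<close>-th power of the hypothesis on \<open>n\<close> produces exactly
  \<open>(2 * 4 ^ k) ^ s * (t - 1)\<close>. The rest is the estimate of a binomial from below by a
  power of the quotient of its arguments.\<close>

lemma binomial_large:
  assumes k: "k \<ge> 2" "k \<le> n" and t: "t \<ge> (2::nat)"
    and n: "2 powr (2 * real s * (1 + 3 / (2 * real k - 2)))
        * (real t - 1) powr (1 / (real k - 1)) * (real k - 1) \<le> real n - 1"
  shows "(2 * 4 ^ k) ^ s * (t - 1) \<le> (n - 1) choose (k - 1)"
proof -
  let ?e = "2 * real s * (1 + 3 / (2 * real k - 2))" and ?q = "1 / (real k - 1)"
  have kr: "real (k - 1) = real k - 1" "real k - 1 > 0" using k by auto
  have e: "?e * real (k - 1) = real (s * (2 * k + 1))"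
    using kr by (simp add: field_simps)
  have "(2 powr ?e * (real t - 1) powr ?q) ^ (k - 1) = 2 powr (?e * real (k - 1)) * (real t - 1) powr (?q * real (k - 1))"
    using k t by (simp only: power_mult_distrib) (simp add: powr_power mult.commute)
  also have "\<dots> = 2 ^ (s * (2 * k + 1)) * (real t - 1)"
    unfolding e using kr t by (simp add: powr_realpow del: of_nat_mult of_nat_add)
  also have "(2::real) ^ (s * (2 * k + 1)) = (2 * 4 ^ k) ^ s"
  proof -
    have "(2::real) * 4 ^ k = 2 ^ (2 * k + 1)" by (simp add: power_mult)
    then show ?thesis by (simp only: power_mult[symmetric] mult.commute[of s])
  qed
  finally have "(2 * 4 ^ k) ^ s * (real t - 1) = (2 powr ?e * (real t - 1) powr ?q) ^ (k - 1)" by simp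
  also have "\<dots> \<le> (real (n - 1) / real (k - 1)) ^ (k - 1)"
    using n kr k by (intro power_mono) (auto simp: field_simps of_nat_diff)
  also have "\<dots> \<le> real ((n - 1) choose (k - 1))"
    using k by (intro binomial_ge_n_over_k_pow_k) auto
  finally have "real ((2 * 4 ^ k) ^ s * (t - 1)) \<le> real ((n - 1) choose (k - 1))"
    using t by (simp add: of_nat_diff)
  then show ?thesis by linarith
qed

section \<open>The extremal problem\<close>

text \<open>Every set outside \<open>X\<close> and \<open>W\<close> is a common neighbour of some
  \<open>s\<close>-set in \<open>T\<close>, and each such \<open>s\<close>-set has at most
  \<open>t - 1\<close> common neighbours.\<close>

lemma layers_bound:
  assumes \<A>: "\<A> \<subseteq> nsets {1..n} k" "union_intersecting s t \<A>" and s: "s \<ge> 1" and t: "t \<ge> 1"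
  obtains W where "W \<subseteq> \<A>" "cross_intersecting W W"
    "card \<A> \<le> card W + (s - 1) * ((2 * k) choose k) + ((2 * k) choose k) ^ s * (t - 1)"
proof -
  let ?C = "(2 * k) choose k"
  have f\<A>: "finite \<A>" using \<A>(1) finite_subset finite_imp_finite_nsets by (metis finite_atLeastAtMost)
  have "\<forall>A\<in>\<A>. finite A \<and> card A = k" using \<A>(1) by (auto simp: nsets_def)
  from dominating_layers[OF s f\<A> this] obtain X W T where
    X: "X \<subseteq> \<A>" "card X \<le> (s - 1) * ?C" and W: "W \<subseteq> \<A>" "cross_intersecting W W" and
    T: "T \<subseteq> nsets \<A> s" "card T \<le> ?C ^ s"
      "\<forall>v\<in>\<A> - X - W. \<exists>Y\<in>T. \<forall>A\<in>Y. v \<inter> A = {}" by (elim exE conjE)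
  have fT: "finite T" using T(1) f\<A> finite_imp_finite_nsets finite_subset by metis
  have "\<A> - X - W \<subseteq> (\<Union>Y\<in>T. {v\<in>\<A>. \<forall>A\<in>Y. v \<inter> A = {}})"
  proof
    fix v assume v: "v \<in> \<A> - X - W"
    then obtain Y where "Y \<in> T" "\<forall>A\<in>Y. v \<inter> A = {}" using T(3) by metis
    then show "v \<in> (\<Union>Y\<in>T. {v\<in>\<A>. \<forall>A\<in>Y. v \<inter> A = {}})" using v by auto
  qed
  then have "card (\<A> - X - W) \<le> card (\<Union>Y\<in>T. {v\<in>\<A>. \<forall>A\<in>Y. v \<inter> A = {}})"
    using fT f\<A> by (intro card_mono) auto
  also have "\<dots> \<le> (\<Sum>Y\<in>T. card {v\<in>\<A>. \<forall>A\<in>Y. v \<inter> A = {}})" by (rule card_UN_le[OF fT])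
  also have "\<dots> \<le> (\<Sum>Y\<in>T. t - 1)"
    using T(1) by (intro sum_mono card_common_neighbours_le[OF f\<A> \<A>(2) t]) blast
  also have "\<dots> \<le> ?C ^ s * (t - 1)" using T(2) by simp
  finally have rest: "card (\<A> - X - W) \<le> ?C ^ s * (t - 1)" .
  have "\<A> = X \<union> W \<union> (\<A> - X - W)" using X W by blast
  then have "card \<A> \<le> card X + card W + card (\<A> - X - W)"
    by (metis add_le_mono1 card_Un_le le_trans)
  then show thesis using that[OF W] X(2) rest by linarith
qed

lemma le_four_power: "s \<ge> 1 \<Longrightarrow> 4 * s \<le> (4::nat) ^ s"
  by (induction s rule: nat_induct_at_least) auto

text \<open>Each of the \<open>s - 1\<close> layers costs at most
  \<open>C \<le> C ^ s * (t - 1)\<close>, so the total is at most \<open>s\<close> times that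
  quantity. The factor \<open>4 * s\<close> is then absorbed by \<open>4 ^ s\<close>, and
  \<open>4 * C\<close> is at most \<open>2 * 4 ^ k\<close>.\<close>

lemma remainder_bound:
  fixes C M s t :: nat
  assumes "s \<ge> 1" "t \<ge> 2" "2 * C \<le> 4 ^ k" "(2 * 4 ^ k) ^ s * (t - 1) \<le> M" "C \<ge> 1"
  shows "4 * ((s - 1) * C + C ^ s * (t - 1)) \<le> M"
proof -
  have "C ^ 1 \<le> C ^ s" using assms(1,5) by (intro power_increasing) auto
  then have "C \<le> C ^ s * (t - 1)" using assms(2) by (simp add: Suc_le_eq le_trans[of C "C ^ s"])
  then have "(s - 1) * C + C ^ s * (t - 1) \<le> (s - 1) * (C ^ s * (t - 1)) + C ^ s * (t - 1)"
    by (intro add_le_mono1 mult_le_mono2)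
  also have "\<dots> = s * (C ^ s * (t - 1))" using assms(1) by (cases s) auto
  finally have "4 * ((s - 1) * C + C ^ s * (t - 1)) \<le> 4 * s * (C ^ s * (t - 1))" by simp
  also have "\<dots> \<le> 4 ^ s * (C ^ s * (t - 1))" using le_four_power[OF assms(1)] by (intro mult_le_mono1)
  also have "\<dots> = (4 * C) ^ s * (t - 1)" by (simp add: power_mult_distrib)
  also have "\<dots> \<le> (2 * 4 ^ k) ^ s * (t - 1)" using assms(3) by (intro mult_le_mono1 power_mono) auto
  finally show ?thesis using assms(4) by linarith
qed

lemma no_large_star_bound:
  fixes n k s t :: nat
  assumes k: "k \<ge> 2" and ts: "t \<ge> s" and s: "s \<ge> 1"
    and n1: "2 * (real s * real k * (real k - 1) + real t - 1) \<le> real n - 1"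
    and n2: "2 powr (2 * real s * (1 + 3 / (2 * real k - 2)))
        * (real t - 1) powr (1 / (real k - 1)) * (real k - 1) \<le> real n - 1"
    and \<A>: "\<A> \<subseteq> nsets {1..n} k" "union_intersecting s t \<A>"
    and nostar: "\<And>i. i \<in> {1..n} \<Longrightarrow> s \<le> card (\<A> - star n k i)"
  shows "card \<A> < (n - 1) choose (k - 1)"
proof -
  define M where "M = (n - 1) choose (k - 1)"
  have kr: "real k \<ge> 2" and sr: "real s \<ge> 1" and tr: "real t \<ge> 1" using k s ts by auto
  have "real k * (real k - 1) \<le> real s * (real k * (real k - 1))"
    using mult_right_mono[OF sr, of "real k * (real k - 1)"] kr by simp
  then have nk: "2 * (real k * (real k - 1)) + 2 * (real t - 1) \<le> real n - 1"
    using n1 by (simp add: mult.assoc)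
  have "real k * 1 \<le> real k * (real k - 1)" using kr by (intro mult_left_mono) auto
  then have "real (2 * k) \<le> real n" using nk tr by simp
  then have n2k: "2 * k \<le> n" by linarith
  have f\<A>: "finite \<A>" using \<A>(1) finite_subset finite_imp_finite_nsets by (metis finite_atLeastAtMost)
  \<comment> \<open>This makes \<open>n - 1\<close> at most \<open>M\<close>, so that the additive
    \<open>t - 1\<close> in the degree bound can be measured in multiples of
    \<open>M\<close>.\<close>
  have "(n - 1) choose 1 \<le> (n - 1) choose (k - 1)" using k n2k by (intro binomial_mono) auto
  then have Mn: "real n - 1 \<le> real M" using n2k k by (simp add: M_def)
  have degree: "2 * real (card {A\<in>\<A>. i \<in> A}) \<le> real M" if i: "i \<in> {1..n}" for i
  proof -
    have n0: "real n - 1 > 0" using n2k k by simp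
    have "card {A\<in>\<A>. i \<in> A} \<le> s * k * ((n - 2) choose (k - 2)) + (t - 1)"
      using degree_bound[OF \<A> _ i nostar[OF i]] ts s by simp
    then have "real (card {A\<in>\<A>. i \<in> A}) \<le> real (s * k * ((n - 2) choose (k - 2)) + (t - 1))"
      by (simp only: of_nat_le_iff)
    then have "real (card {A\<in>\<A>. i \<in> A}) \<le> real s * real k * real ((n - 2) choose (k - 2)) + (real t - 1)"
      using ts s by (simp add: of_nat_diff)
    then have "real (card {A\<in>\<A>. i \<in> A}) * (real n - 1)
        \<le> (real s * real k * real ((n - 2) choose (k - 2)) + (real t - 1)) * (real n - 1)"
      using n0 by (intro mult_right_mono) auto
    also have "\<dots> = real s * real k * ((real n - 1) * real ((n - 2) choose (k - 2))) + (real t - 1) * (real n - 1)"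
      by (simp add: algebra_simps)
    also have "(real n - 1) * real ((n - 2) choose (k - 2)) = (real k - 1) * real M"
      unfolding M_def using k n2k by (intro binomial_neighbour_identities(1)) auto
    also have "(real t - 1) * (real n - 1) \<le> (real t - 1) * real M"
      using Mn tr by (intro mult_left_mono) auto
    also have "real s * real k * ((real k - 1) * real M) + (real t - 1) * real M
        = (real s * real k * (real k - 1) + real t - 1) * real M"
      by (simp add: algebra_simps)
    also have "\<dots> \<le> (real n - 1) / 2 * real M"
      using n1 by (intro mult_right_mono) auto
    finally have "2 * real (card {A\<in>\<A>. i \<in> A}) * (real n - 1) \<le> real M * (real n - 1)"
      by (simp add: mult.commute)
    then show ?thesis using n0 by (rule mult_right_le_imp_le)
  qed
  obtain W where W: "W \<subseteq> \<A>" "cross_intersecting W W" and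
    bound: "card \<A> \<le> card W + (s - 1) * ((2 * k) choose k) + ((2 * k) choose k) ^ s * (t - 1)"
    using layers_bound[OF \<A> s] ts s by auto
  have W_frac: "real (card W) < (1 / 2 + 1 / c) * real M"
    if c: "c > 0" "c * (real k - 1) < real n - real k + 1" for c
  \<comment> \<open>If the members of \<open>W\<close> share a point, the degree bound gives half of
    \<open>M\<close>. An empty \<open>W\<close> is treated apart, since then the shared point need
    not lie in \<open>{1..n}\<close>.\<close>
  proof (cases "\<exists>x. \<forall>A\<in>W. x \<in> A")
    case True
    then obtain x where x: "\<And>A. A \<in> W \<Longrightarrow> x \<in> A" by blast
    have M0: "real M > 0" using Mn n2k k by linarith
    have "2 * real (card W) \<le> real M"
    proof (cases "W = {}")
      case False
      then obtain A where "A \<in> W" by blast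
      then have "A \<subseteq> {1..n}" "x \<in> A" using x[of A] W(1) \<A>(1) unfolding nsets_def by blast+
      then have "x \<in> {1..n}" by blast
      moreover have "card W \<le> card {A\<in>\<A>. x \<in> A}"
        using W(1) x f\<A> by (intro card_mono) auto
      ultimately show ?thesis using degree[of x] by linarith
    qed (use M0 in simp)
    moreover have "1 / c * real M > 0" using c(1) M0 by simp
    ultimately show ?thesis by (simp add: algebra_simps)
  next
    case False
    then show ?thesis
      unfolding M_def using W \<A>(1) nk tr c
      by (intro nonstar_intersecting_fraction[OF k n2k]) auto
  qed
  show ?thesis
  proof (cases "t = 1")
    \<comment> \<open>Now \<open>s = 1\<close> as well, so both exceptional terms vanish and
      \<open>c = 2\<close> suffices. The choice \<open>c = 4\<close> can fail here, for instance at
      \<open>k = 2\<close>, \<open>n = 5\<close>.\<close>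
    case True
    then have "card \<A> \<le> card W" using bound ts s by simp
    moreover have "2 * (real k - 1) < real n - real k + 1"
    proof -
      \<comment> \<open>With \<open>y = k - 1\<close>, the bound \<open>nk\<close> reduces the claim
        to positivity of \<open>2 * y^2 - y + 1\<close>, seen by completing the square.\<close>
      have "0 < 2 * (real k - 1)^2 - (real k - 1) + 1" using zero_le_power2[of "4 * (real k - 1) - 1"]
        by (simp add: power2_eq_square algebra_simps)
      then show ?thesis using nk tr by (simp add: power2_eq_square algebra_simps)
    qed
    ultimately show ?thesis using W_frac[of 2] by (simp add: M_def)
  next
    case False
    then have t2: "t \<ge> 2" using ts s by simp
    \<comment> \<open>The term \<open>2 * (t - 1) \<ge> 2\<close> in \<open>nk\<close> now makes
      room for \<open>c = 4\<close>, leaving a quarter of \<open>M\<close> for the exceptional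
      sets.\<close>
    have "4 * (real k - 1) < real n - real k + 1"
    proof -
      have "0 < 2 * (real k - 1)^2 - 3 * (real k - 1) + 3"
        using zero_le_power2[of "4 * (real k - 1) - 3"] by (simp add: power2_eq_square algebra_simps)
      moreover have "real t \<ge> 2" using t2 by simp
      ultimately show ?thesis using nk by (simp add: power2_eq_square algebra_simps)
    qed
    then have "4 * real (card W) < 3 * real M" using W_frac[of 4] by simp
    then have "4 * card W < 3 * M" by linarith
    moreover have "4 * ((s - 1) * ((2 * k) choose k) + ((2 * k) choose k) ^ s * (t - 1)) \<le> M"
      unfolding M_def using central_binomial_le[of k] binomial_large[OF k _ t2 n2] k n2k
      by (intro remainder_bound[OF s t2, of _ k]) (auto simp: Suc_le_eq)
    moreover have "card \<A> \<le> card W + ((s - 1) * ((2 * k) choose k) + ((2 * k) choose k) ^ s * (t - 1))"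
      using bound by (simp only: add.assoc)
    moreover have "a < M" if "4 * w < 3 * M" "4 * e \<le> M" "a \<le> w + e" for a w e
      using that by linarith
    ultimately have "card \<A> < M" by blast
    then show ?thesis by (simp add: M_def)
  qed
qed

theorem theorem2:
  fixes n k s t :: nat and \<A> :: "nat set set"
  assumes "k \<ge> 2" and "t \<ge> s" and "s \<ge> 1"
    and "real n \<ge> 1 + max
           (2 * (real s * real k * (real k - 1) + real t - 1))
           (2 powr (2 * real s * (1 + 3 / (2 * real k - 2)))
              * (real t - 1) powr (1 / (real k - 1)) * (real k - 1))"
    and "\<A> \<subseteq> nsets {1..n} k"
    and "union_intersecting s t \<A>"
  shows "card \<A> \<le> ((n - 1) choose (k - 1)) + (s - 1)
    \<and> (card \<A> = ((n - 1) choose (k - 1)) + (s - 1) \<longleftrightarrow>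
         (\<exists>i \<in> {1..n}. \<exists>\<B>. \<B> \<subseteq> nsets {1..n} k - star n k i \<and> card \<B> = s - 1
            \<and> \<A> = star n k i \<union> \<B>))"
proof -
  let ?M = "(n - 1) choose (k - 1)"
  have fin: "finite (nsets {1..n} k)" by (simp add: finite_imp_finite_nsets)
  have f\<A>: "finite \<A>" using assms(5) fin by (rule finite_subset)
  have fstar: "finite (star n k i)" for i using fin by (simp add: star_def)
  have converse: "card \<A> = ?M + (s - 1)"
    if "i \<in> {1..n}" "\<B> \<subseteq> nsets {1..n} k - star n k i" "card \<B> = s - 1" "\<A> = star n k i \<union> \<B>" for i \<B>
  proof -
    have "finite \<B>" using f\<A> that(4) by simp
    moreover have "star n k i \<inter> \<B> = {}" using that(2) by blast
    ultimately have "card \<A> = card (star n k i) + card \<B>"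
      unfolding that(4) using fstar by (intro card_Un_disjoint)
    then show ?thesis using that assms(1) by (simp add: card_star)
  qed
  show ?thesis
  proof (cases "\<exists>i\<in>{1..n}. card (\<A> - star n k i) < s")
    case True
    then obtain i where i: "i \<in> {1..n}" "card (\<A> - star n k i) \<le> s - 1" by auto
    have cs: "card (star n k i) = ?M" using i(1) assms(1) by (simp add: card_star)
    have split: "card \<A> = card (\<A> \<inter> star n k i) + card (\<A> - star n k i)"
      using f\<A> by (simp add: card_Diff_subset_Int card_mono)
    have le: "card (\<A> \<inter> star n k i) \<le> ?M" unfolding cs[symmetric] using fstar by (intro card_mono) auto
    have "\<exists>i \<in> {1..n}. \<exists>\<B>. \<B> \<subseteq> nsets {1..n} k - star n k i \<and> card \<B> = s - 1 \<and> \<A> = star n k i \<union> \<B>"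
      if "card \<A> = ?M + (s - 1)"
    proof (intro bexI[OF _ i(1)] exI conjI)
      \<comment> \<open>Equality in the sum forces equality in both summands, so the whole star is
        present and the remaining members serve as \<open>\<B>\<close>.\<close>
      have eq: "card (\<A> - star n k i) = s - 1" "card (\<A> \<inter> star n k i) = card (star n k i)"
        using that split le i(2) cs by linarith+
      show "card (\<A> - star n k i) = s - 1" by (rule eq)
      have "\<A> \<inter> star n k i = star n k i" using eq(2) fstar by (intro card_subset_eq) auto
      then show "\<A> = star n k i \<union> (\<A> - star n k i)" by blast
      show "\<A> - star n k i \<subseteq> nsets {1..n} k - star n k i" using assms(5) by blast
    qed
    then show ?thesis using split le i(2) converse by (metis add_mono)
  next
    case False
    then have "card \<A> < ?M"
      using assms by (intro no_large_star_bound[of k s t n]) (auto simp: not_less)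
    \<comment> \<open>The strict inequality rules out equality, and \<open>converse\<close> then
      rules out the described structure, so both sides of the equivalence are false.\<close>
    then show ?thesis using converse by fastforce
  qed
qed

end
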